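(* Let $\widehat S$ be a subgroup of $\widehat M$. Then $\widehat S$ is a Neumann subgroup of $\widehat M$ if and only if the set $\{\tau^n,\ \tau^n\nu : n\in\mathbb Z\}$ forms a complete system of distinct right coset representatives of $\widehat S$ in $\widehat M$, i.e. every right coset $\widehat S\alpha$ ($\alpha\in\widehat M$) contains exactly one of the elements $\tau^n$, $\tau^n\nu$ ($n\in\mathbb Z$).
   Context: Let $\widehat M$ be the extended modular group, i.e. the group of all maps $z\mapsto \frac{az+b}{cz+d}$ with $a,b,c,d\in\mathbb Z$, $ad-bc=\pm1$, acting on $\overline{\mathbb Q}=\mathbb Q\cup\{\infty\}$ (with the usual conventions for $\infty$). Let $\tau(z)=z+1$ and $\nu(z)=-z$, which are elements of $\widehat M$. Products in $\widehat M$ are compositions of maps, $(\alpha\beta)(z)=\alpha(\beta(z))$. A subgroup $\widehat S\subset\widehat M$ is a Neumann subgroup of $\widehat M$ if for every $r\in\overline{\mathbb Q}$ there exists exactly one $\alpha\in\widehat S$ with $\alpha(\infty)=r$. *)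

theory Defs
  imports Complex_Main "HOL-Algebra.Coset"
begin

datatype qbar = Fin rat | Infty

primrec moebius :: "int \<Rightarrow> int \<Rightarrow> int \<Rightarrow> int \<Rightarrow> qbar \<Rightarrow> qbar" where
  "moebius a b c d (Fin z) =
     (if of_int c * z + of_int d = 0 then Infty
      else Fin ((of_int a * z + of_int b) / (of_int c * z + of_int d)))"
| "moebius a b c d Infty = (if c = 0 then Infty else Fin (of_int a / of_int c))"

text \<open>Elements of the extended modular group are maps, not matrices: a matrix and its
  negative give the same element. Determinant \<open>-1\<close> is allowed, and such maps are
  fractional linear as well (no complex conjugation is involved).\<close>

definition ext_modular_group :: "(qbar \<Rightarrow> qbar) monoid" where
  "ext_modular_group =
     \<lparr>carrier = {moebius a b c d | a b c d. a * d - b * c = 1 \<or> a * d - b * c = - 1},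
      monoid.mult = (\<circ>), one = id\<rparr>"

primrec tau :: "qbar \<Rightarrow> qbar" where
  "tau (Fin z) = Fin (z + 1)"
| "tau Infty = Infty"

primrec nu :: "qbar \<Rightarrow> qbar" where
  "nu (Fin z) = Fin (- z)"
| "nu Infty = Infty"

definition neumann_subgroup :: "(qbar \<Rightarrow> qbar) set \<Rightarrow> bool" where
  "neumann_subgroup S \<longleftrightarrow>
     subgroup S ext_modular_group \<and> (\<forall>r. \<exists>!\<alpha>. \<alpha> \<in> S \<and> \<alpha> Infty = r)"

lemma tau_eq_moebius: "tau = moebius 1 1 0 1"
proof
  show "tau x = moebius 1 1 0 1 x" for x by (cases x) simp_all
qed

lemma nu_eq_moebius: "nu = moebius (- 1) 0 0 1"
proof
  show "nu x = moebius (- 1) 0 0 1 x" for x by (cases x) simp_all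
qed

lemma tau_in_ext_modular_group: "tau \<in> carrier ext_modular_group"
  unfolding ext_modular_group_def tau_eq_moebius by force

lemma nu_in_ext_modular_group: "nu \<in> carrier ext_modular_group"
  unfolding ext_modular_group_def nu_eq_moebius by force

lemma moebius_id: "moebius 1 0 0 1 = id"
proof
  show "moebius 1 0 0 1 x = id x" for x by (cases x) simp_all
qed

lemma moebius_comp:
  assumes "a' * d' - b' * c' \<noteq> 0"
  shows "moebius a b c d \<circ> moebius a' b' c' d' =
    moebius (a * a' + b * c') (a * b' + b * d') (c * a' + d * c') (c * b' + d * d')"
proof
  fix x
  have det: "of_int a' * of_int d' - of_int b' * of_int c' \<noteq> (0 :: rat)"
    using assms by (metis of_int_0_eq_iff of_int_diff of_int_mult)
  show "(moebius a b c d \<circ> moebius a' b' c' d') x =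
    moebius (a * a' + b * c') (a * b' + b * d') (c * a' + d * c') (c * b' + d * d') x"
  proof (cases x)
    case Infty
    define n m :: rat where "n = of_int a'" and "m = of_int c'"
    have nm: "m = 0 \<Longrightarrow> n \<noteq> 0"
      using assms by (auto simp: n_def m_def)
    have c0: "c' = 0 \<longleftrightarrow> m = 0"
      by (simp add: m_def)
    have den0: "c * a' + d * c' = 0 \<longleftrightarrow> of_int c * n + of_int d * m = 0"
      unfolding n_def m_def by (simp flip: of_int_mult of_int_add)
    have num: "of_int (a * a' + b * c') = of_int a * n + of_int b * m"
      and den: "of_int (c * a' + d * c') = of_int c * n + of_int d * m"
      by (simp_all add: n_def m_def)
    have quot: "m \<noteq> 0 \<Longrightarrow> of_int p * (n / m) + of_int q = (of_int p * n + of_int q * m) / m" for p q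
      by (simp add: field_simps)
    show ?thesis
      unfolding Infty comp_def moebius.simps c0 den0 num den n_def[symmetric] m_def[symmetric]
      using nm by (cases "m = 0") (simp_all add: quot del: times_divide_eq_right)
  next
    case (Fin z)
    define n where "n = of_int a' * z + of_int b'"
    define m where "m = of_int c' * z + of_int d'"
    have nm: "m = 0 \<Longrightarrow> n \<noteq> 0"
    proof
      assume "m = 0" "n = 0"
      then have "of_int a' * m - of_int c' * n = 0" by simp
      then have "of_int a' * of_int d' - of_int b' * of_int c' = (0::rat)"
        by (simp add: m_def n_def algebra_simps)
      with det show False by simp
    qed
    have num: "of_int (a * a' + b * c') * z + of_int (a * b' + b * d') = of_int a * n + of_int b * m"
      and den: "of_int (c * a' + d * c') * z + of_int (c * b' + d * d') = of_int c * n + of_int d * m"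
      by (simp_all add: n_def m_def algebra_simps)
    have quot: "m \<noteq> 0 \<Longrightarrow> of_int p * (n / m) + of_int q = (of_int p * n + of_int q * m) / m" for p q
      by (simp add: field_simps)
    show ?thesis
      unfolding Fin comp_def moebius.simps num den n_def[symmetric] m_def[symmetric]
      using nm by (cases "m = 0") (simp_all add: quot del: times_divide_eq_right)
  qed
qed

lemma group_ext_modular_group: "group ext_modular_group"
proof (rule groupI)
  fix x y
  assume "x \<in> carrier ext_modular_group" "y \<in> carrier ext_modular_group"
  then obtain a b c d a' b' c' d' where x: "x = moebius a b c d" "\<bar>a * d - b * c\<bar> = 1"
    and y: "y = moebius a' b' c' d'" "\<bar>a' * d' - b' * c'\<bar> = 1"
    unfolding ext_modular_group_def by fastforce
  have "(a * a' + b * c') * (c * b' + d * d') - (a * b' + b * d') * (c * a' + d * c')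
      = (a * d - b * c) * (a' * d' - b' * c')"
    by (simp add: algebra_simps)
  then have "\<bar>(a * a' + b * c') * (c * b' + d * d') - (a * b' + b * d') * (c * a' + d * c')\<bar> = 1"
    using x y by (simp add: abs_mult)
  moreover have "x \<circ> y =
      moebius (a * a' + b * c') (a * b' + b * d') (c * a' + d * c') (c * b' + d * d')"
    unfolding x y using y by (intro moebius_comp) auto
  ultimately show "x \<otimes>\<^bsub>ext_modular_group\<^esub> y \<in> carrier ext_modular_group"
    by (auto simp: ext_modular_group_def abs_if split: if_splits) (metis minus_diff_eq minus_minus)+
next
  show "\<one>\<^bsub>ext_modular_group\<^esub> \<in> carrier ext_modular_group"
    using moebius_id[symmetric] by (force simp: ext_modular_group_def)
next
  fix x
  assume "x \<in> carrier ext_modular_group"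
  then obtain a b c d where x: "x = moebius a b c d" "a * d - b * c = 1 \<or> a * d - b * c = - 1"
    by (auto simp: ext_modular_group_def)
  define e where "e = a * d - b * c"
  have e: "e * e = 1" using x(2) e_def by auto
  have inv: "moebius (e * d) (- e * b) (- e * c) (e * a) \<circ> x = id"
  proof -
    have "e * d * a + (- e * b) * c = 1" "- e * c * b + e * a * d = 1"
      using e unfolding e_def by (simp_all add: algebra_simps)
    then show ?thesis
      unfolding x(1) using x(2) by (subst moebius_comp) (auto simp: moebius_id[symmetric])
  qed
  have "(e * d) * (e * a) - (- e * b) * (- e * c) = (e * e) * e"
    unfolding e_def by (simp add: algebra_simps)
  then have "moebius (e * d) (- e * b) (- e * c) (e * a) \<in> carrier ext_modular_group"
    using e x(2) unfolding ext_modular_group_def e_def[symmetric] by fastforce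
  with inv show "\<exists>y\<in>carrier ext_modular_group. y \<otimes>\<^bsub>ext_modular_group\<^esub> x = \<one>\<^bsub>ext_modular_group\<^esub>"
    by (intro bexI) (simp_all add: ext_modular_group_def)
qed (auto simp: ext_modular_group_def comp_assoc)

end

theory Submission
  imports Defs
begin

text \<open>The candidate representatives are exactly the stabilizer of \<open>\<infinity>\<close> in the extended modular
  group, since a map with \<open>c = 0\<close> has \<open>a * d = \<plusminus>1\<close> and is therefore \<open>z \<mapsto> \<plusminus>z + n\<close>
  (lemma \<open>stabilizer_Infty\<close>). For a fixed element \<open>g\<close>, the map \<open>\<alpha> \<mapsto> \<alpha>\<inverse>g\<close> sends the elements of
  \<open>S\<close> that take \<open>\<infinity>\<close> to \<open>g(\<infinity>)\<close> bijectively onto the elements of the coset \<open>Sg\<close> that fix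
  \<open>\<infinity>\<close>, so one set is a singleton if and only if the other is (lemma \<open>coset_stabilizer_unique_iff\<close>).
  Since the group is transitive on the extended rationals (lemma \<open>ext_modular_group_transitive\<close>),
  \<open>g(\<infinity>)\<close> runs through all points as \<open>Sg\<close> runs through all right cosets.\<close>

interpretation ext_modular: group ext_modular_group
  by (rule group_ext_modular_group)

lemma mult_ext_modular_group [simp]: "x \<otimes>\<^bsub>ext_modular_group\<^esub> y = x \<circ> y"
  by (simp add: ext_modular_group_def)

lemma one_ext_modular_group [simp]: "\<one>\<^bsub>ext_modular_group\<^esub> = id"
  by (simp add: ext_modular_group_def)

lemma inv_apply_apply:
  assumes "x \<in> carrier ext_modular_group"
  shows "(inv\<^bsub>ext_modular_group\<^esub> x) (x z) = z"
  using ext_modular.l_inv[OF assms] by (simp add: fun_eq_iff)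

lemma translation_in_ext_modular_group: "moebius 1 n 0 1 \<in> carrier ext_modular_group"
  unfolding ext_modular_group_def by force

lemma tau_nat_pow: "tau [^]\<^bsub>ext_modular_group\<^esub> (n :: nat) = moebius 1 (int n) 0 1"
  by (induction n) (simp_all add: moebius_id tau_eq_moebius moebius_comp)

lemma tau_int_pow: "tau [^]\<^bsub>ext_modular_group\<^esub> (n :: int) = moebius 1 n 0 1"
proof (cases "n < 0")
  case True
  have "inv\<^bsub>ext_modular_group\<^esub> (moebius 1 (- n) 0 1) = moebius 1 n 0 1"
    by (rule ext_modular.inv_equality)
      (simp_all add: moebius_comp moebius_id translation_in_ext_modular_group)
  with True show ?thesis
    by (simp add: int_pow_def2 tau_nat_pow)
next
  case False
  then show ?thesis
    by (simp add: int_pow_def2 tau_nat_pow)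
qed

lemma tau_int_pow_nu:
  "tau [^]\<^bsub>ext_modular_group\<^esub> (n :: int) \<otimes>\<^bsub>ext_modular_group\<^esub> nu = moebius (- 1) n 0 1"
  by (simp add: tau_int_pow nu_eq_moebius moebius_comp)

lemma moebius_uminus: "moebius (- a) (- b) (- c) (- d) = moebius a b c d"
proof
  fix x
  show "moebius (- a) (- b) (- c) (- d) x = moebius a b c d x"
  proof (cases x)
    case (Fin z)
    have num: "of_int (- a) * z + of_int (- b) = - (of_int a * z + of_int b)"
      and den: "of_int (- c) * z + of_int (- d) = - (of_int c * z + of_int d)"
      by simp_all
    show ?thesis
      unfolding Fin moebius.simps num den by (simp only: neg_equal_0_iff_equal minus_divide_divide)
  qed simp
qed

lemma stabilizer_Infty:
  "{t \<in> carrier ext_modular_group. t Infty = Infty} =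
    {tau [^]\<^bsub>ext_modular_group\<^esub> n | n :: int. True} \<union>
    {tau [^]\<^bsub>ext_modular_group\<^esub> n \<otimes>\<^bsub>ext_modular_group\<^esub> nu | n :: int. True}"
  (is "?L = ?R")
proof
  show "?L \<subseteq> ?R"
  proof
    fix t
    assume "t \<in> ?L"
    then obtain a b c d where t: "t = moebius a b c d"
      and det: "a * d - b * c = 1 \<or> a * d - b * c = - 1" and "t Infty = Infty"
      by (auto simp: ext_modular_group_def)
    then have "c = 0"
      by (auto split: if_splits)
    with det have ad: "a * d = 1 \<or> a * d = - 1"
      by simp
    then have "\<bar>d\<bar> = 1"
      by (metis abs_minus_cancel abs_1 abs_zmult_eq_1 mult.commute)
    \<comment> \<open>A matrix and its negative give the same map, so the lower right entry may be taken to be 1.\<close>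
    have "\<exists>a' b'. t = moebius a' b' 0 1 \<and> (a' = 1 \<or> a' = - 1)"
    proof (cases "d = 1")
      case True
      with t ad \<open>c = 0\<close> show ?thesis
        by auto
    next
      case False
      with \<open>\<bar>d\<bar> = 1\<close> have "d = - 1"
        by linarith
      then have "t = moebius (- a) (- b) 0 1"
        using t \<open>c = 0\<close> moebius_uminus[of a b 0 d] by simp
      moreover have "- a = 1 \<or> - a = - 1"
        using ad \<open>d = - 1\<close> by auto
      ultimately show ?thesis
        by blast
    qed
    then show "t \<in> ?R"
      unfolding tau_int_pow_nu unfolding tau_int_pow by blast
  qed
  have "moebius a n 0 1 \<in> ?L" if "a = 1 \<or> a = - 1" for a n :: int
  proof -
    have "a * 1 - n * 0 = 1 \<or> a * 1 - n * 0 = - 1"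
      using that by simp
    then have "moebius a n 0 1 \<in> carrier ext_modular_group"
      unfolding ext_modular_group_def partial_object.simps by blast
    then show ?thesis
      by simp
  qed
  then show "?R \<subseteq> ?L"
    unfolding tau_int_pow_nu unfolding tau_int_pow by blast
qed

text \<open>A reduced fraction is the first column of a matrix of determinant 1, by Bezout.\<close>

lemma ext_modular_group_transitive: "\<exists>g \<in> carrier ext_modular_group. g Infty = r"
proof (cases r)
  case Infty
  then show ?thesis
    using tau_in_ext_modular_group tau.simps(2) by blast
next
  case (Fin z)
  obtain p q where "quotient_of z = (p, q)"
    by fastforce
  then have z: "z = of_int p / of_int q" and "q > 0" and "coprime p q"
    by (auto dest: quotient_of_div quotient_of_denom_pos quotient_of_coprime)
  obtain u v where "u * p + v * q = 1"
    using bezout_int[of p q] \<open>coprime p q\<close> by auto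
  then have "moebius p (- v) q u \<in> carrier ext_modular_group"
    unfolding ext_modular_group_def by (force simp: algebra_simps)
  moreover have "moebius p (- v) q u Infty = r"
    using z Fin \<open>q > 0\<close> by simp
  ultimately show ?thesis
    by blast
qed

text \<open>Both sides count the same things: if \<open>\<alpha> \<in> S\<close> agrees with \<open>g\<close> at \<open>\<infinity>\<close>, then
  \<open>\<alpha>\<inverse>g \<in> Sg\<close> fixes \<open>\<infinity>\<close>; conversely \<open>t = sg\<close> fixing \<open>\<infinity>\<close> comes from
  \<open>\<alpha> = gt\<inverse> = s\<inverse>\<close>.\<close>

lemma coset_stabilizer_unique_iff:
  assumes S: "subgroup S ext_modular_group" and g: "g \<in> carrier ext_modular_group"
  shows "(\<exists>!t. t \<in> S #>\<^bsub>ext_modular_group\<^esub> g \<and> t Infty = Infty) \<longleftrightarrow>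
    (\<exists>!\<alpha>. \<alpha> \<in> S \<and> \<alpha> Infty = g Infty)"
proof -
  let ?G = ext_modular_group
  let ?A = "{\<alpha> \<in> S. \<alpha> Infty = g Infty}"
  let ?T = "{t \<in> S #>\<^bsub>?G\<^esub> g. t Infty = Infty}"
  let ?f = "\<lambda>\<alpha>. inv\<^bsub>?G\<^esub> \<alpha> \<otimes>\<^bsub>?G\<^esub> g"
  have mem: "s \<in> carrier ?G" if "s \<in> S" for s
    using subgroup.mem_carrier[OF S that] .
  have inj: "inj_on ?f ?A"
  proof (rule inj_onI)
    fix x y
    assume "x \<in> ?A" "y \<in> ?A" "?f x = ?f y"
    then have "inv\<^bsub>?G\<^esub> x = inv\<^bsub>?G\<^esub> y"
      using g mem by (subst (asm) ext_modular.right_cancel) auto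
    with \<open>x \<in> ?A\<close> \<open>y \<in> ?A\<close> show "x = y"
      using mem ext_modular.inv_inv by (metis (no_types, lifting) mem_Collect_eq)
  qed
  have "?f ` ?A = ?T"
  proof
    show "?f ` ?A \<subseteq> ?T"
    proof
      fix t
      assume "t \<in> ?f ` ?A"
      then obtain x where x: "x \<in> S" "x Infty = g Infty" "t = ?f x"
        by auto
      then have "t Infty = Infty"
        using inv_apply_apply[OF mem, of x Infty] by simp
      moreover have "t \<in> S #>\<^bsub>?G\<^esub> g"
        using x subgroup.m_inv_closed[OF S] unfolding r_coset_def by blast
      ultimately show "t \<in> ?T"
        by simp
    qed
    show "?T \<subseteq> ?f ` ?A"
    proof
      fix t
      assume "t \<in> ?T"
      then obtain s where s: "s \<in> S" "t = s \<otimes>\<^bsub>?G\<^esub> g" "t Infty = Infty"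
        unfolding r_coset_def by blast
      then have "(inv\<^bsub>?G\<^esub> s) Infty = g Infty"
        using inv_apply_apply[OF mem, of s "g Infty"] by simp
      then have "inv\<^bsub>?G\<^esub> s \<in> ?A"
        using s subgroup.m_inv_closed[OF S] by blast
      moreover have "t = ?f (inv\<^bsub>?G\<^esub> s)"
        using s mem by simp
      ultimately show "t \<in> ?f ` ?A"
        by blast
    qed
  qed
  with inj have "bij_betw ?f ?A ?T"
    by (simp add: bij_betw_def)
  then have "card ?T = 1 \<longleftrightarrow> card ?A = 1"
    by (simp only: bij_betw_same_card)
  moreover have "card X = 1 \<longleftrightarrow> (\<exists>!x. x \<in> X)" for X :: "(qbar \<Rightarrow> qbar) set"
    unfolding card_1_singleton_iff One_nat_def by blast
  ultimately show ?thesis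
    by simp
qed

theorem mainTheorem3:
  fixes S :: "(qbar \<Rightarrow> qbar) set"
  assumes "subgroup S ext_modular_group"
  shows "neumann_subgroup S \<longleftrightarrow>
    (\<forall>C \<in> rcosets\<^bsub>ext_modular_group\<^esub> S.
      \<exists>!t. t \<in> C \<and>
        t \<in> {tau [^]\<^bsub>ext_modular_group\<^esub> n | n :: int. True} \<union>
            {tau [^]\<^bsub>ext_modular_group\<^esub> n \<otimes>\<^bsub>ext_modular_group\<^esub> nu | n :: int. True})"
proof -
  let ?G = ext_modular_group
  have coset: "S #>\<^bsub>?G\<^esub> g \<subseteq> carrier ?G" if "g \<in> carrier ?G" for g
    using ext_modular.r_coset_subset_G[OF subgroup.subset[OF assms] that] .
  have "neumann_subgroup S \<longleftrightarrow> (\<forall>r. \<exists>!\<alpha>. \<alpha> \<in> S \<and> \<alpha> Infty = r)"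
    using assms by (simp add: neumann_subgroup_def)
  also have "\<dots> \<longleftrightarrow> (\<forall>g \<in> carrier ?G. \<exists>!\<alpha>. \<alpha> \<in> S \<and> \<alpha> Infty = g Infty)"
  proof
    assume R: "\<forall>g \<in> carrier ?G. \<exists>!\<alpha>. \<alpha> \<in> S \<and> \<alpha> Infty = g Infty"
    show "\<forall>r. \<exists>!\<alpha>. \<alpha> \<in> S \<and> \<alpha> Infty = r"
    proof
      fix r
      obtain g where g: "g \<in> carrier ?G" "g Infty = r"
        using ext_modular_group_transitive by blast
      show "\<exists>!\<alpha>. \<alpha> \<in> S \<and> \<alpha> Infty = r"
        using bspec[OF R g(1)] by (simp only: g(2))
    qed
  qed simp
  also have "\<dots> \<longleftrightarrow> (\<forall>g \<in> carrier ?G. \<exists>!t. t \<in> S #>\<^bsub>?G\<^esub> g \<and> t Infty = Infty)"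
    using coset_stabilizer_unique_iff[OF assms] by simp
  also have "\<dots> \<longleftrightarrow> (\<forall>g \<in> carrier ?G. \<exists>!t. t \<in> S #>\<^bsub>?G\<^esub> g \<and>
      t \<in> {t \<in> carrier ?G. t Infty = Infty})"
  proof (rule ball_cong[OF refl])
    fix g
    assume "g \<in> carrier ?G"
    then have "t \<in> S #>\<^bsub>?G\<^esub> g \<and> t Infty = Infty \<longleftrightarrow>
        t \<in> S #>\<^bsub>?G\<^esub> g \<and> t \<in> {t \<in> carrier ?G. t Infty = Infty}" for t
      using coset by blast
    then show "(\<exists>!t. t \<in> S #>\<^bsub>?G\<^esub> g \<and> t Infty = Infty) \<longleftrightarrow>
        (\<exists>!t. t \<in> S #>\<^bsub>?G\<^esub> g \<and> t \<in> {t \<in> carrier ?G. t Infty = Infty})"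
      by (simp only:)
  qed
  finally show ?thesis
    unfolding stabilizer_Infty RCOSETS_def by simp
qed

end
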